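(* Let $\theta,\theta'\in\mathbb{R}$ and let $$|\mathrm{Mmee}\rangle_{AB}=\frac{1}{\sqrt{2}}\left(|00\rangle_{AB}+|11\rangle_{AB}\right),\qquad |\mathrm{mMee}\rangle_{AB}=\frac{1}{\sqrt{2}}\left(e^{i\theta}|01\rangle_{AB}+e^{i\theta'}|10\rangle_{AB}\right).$$ The pairs of entangled diagonal states completing these two states to an orthonormal basis of $\mathbb{C}^2\otimes\mathbb{C}^2$ are, up to global phases, exactly the pairs characterized by two complex numbers $a,b$ satisfying $$|a|^2+|b|^2=\frac12,\qquad e^{i(\theta'-\theta)}b^2\neq a^2,\qquad e^{i\frac{\theta'-\theta}{2}}a^*b+e^{-i\frac{\theta'-\theta}{2}}ab^*=0,$$ through the Schmidt decompositions $$|\mathrm{mmEe}\rangle_{AB}=\frac{1}{\sqrt2}\left(\sqrt2\begin{bmatrix}a \\ -e^{i(\theta'-\theta)}b\end{bmatrix}\right)_A\otimes|0\rangle_B+\frac{1}{\sqrt2}\left(\sqrt2\begin{bmatrix}b \\ -a\end{bmatrix}\right)_A\otimes|1\rangle_B,$$ $$|\mathrm{mmeE}\rangle_{AB}=\frac{1}{\sqrt2}\left(\sqrt2\begin{bmatrix}b^* \\ e^{i(\theta'-\theta)}a^*\end{bmatrix}\right)_A\otimes|0\rangle_B+\frac{1}{\sqrt2}\left(\sqrt2\begin{bmatrix}-a^* \\ -b^*\end{bmatrix}\right)_A\otimes|1\rangle_B.$$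
   Context: $|0\rangle,|1\rangle$ is the standard basis of $\mathbb{C}^2$, $|jk\rangle_{AB}=|j\rangle_A\otimes|k\rangle_B$, column vectors are with respect to the standard basis, and $^*$ is complex conjugation. A state is a unit vector; a state in $\mathbb{C}^2\otimes\mathbb{C}^2$ is a product state if it equals $|u\rangle\otimes|v\rangle$, and entangled otherwise. A state $\sum_{j,k}c_{jk}|jk\rangle_{AB}$ is called diagonal if $c_{00}^*c_{01}+c_{10}^*c_{11}=0$. A Schmidt decomposition of a state is an expression $\sum_j\lambda_j|u_j\rangle\otimes|v_j\rangle$ with $\lambda_j\ge 0$ and $\{|u_j\rangle\}$, $\{|v_j\rangle\}$ orthonormal families in $\mathbb{C}^2$. "Up to global phases" means each state may be multiplied by a complex number of modulus one. *)

theory Defs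
  imports "HOL-Analysis.Analysis"
begin

type_synonym qubit = "complex ^ 2"

(* The coefficient c_jk of |jk> is the component at index (j, k). *)
type_synonym two_qubit = "complex ^ (2 \<times> 2)"

(* The basis labels 0 and 1 are the elements of the index type 2.  Since 2 = 0 in that type,
   the library's "vector [x, y]" puts x at index 1 and y at index 0; hence "col" below. *)
definition ket :: "2 \<Rightarrow> qubit"
  where "ket j = axis j 1"

definition col :: "complex \<Rightarrow> complex \<Rightarrow> qubit"
  where "col x y = x *s ket 0 + y *s ket 1"

definition tensor :: "qubit \<Rightarrow> qubit \<Rightarrow> two_qubit"  (infixr \<open>\<otimes>\<^sub>q\<close> 77)
  where "u \<otimes>\<^sub>q v = (\<chi> p. u $ fst p * v $ snd p)"

definition ket2 :: "2 \<Rightarrow> 2 \<Rightarrow> two_qubit"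
  where "ket2 j k = ket j \<otimes>\<^sub>q ket k"

(* The library's inner product on complex vectors is the real one; this is the Hermitian one,
   inducing the library norm. *)
definition herm :: "complex ^ 'n \<Rightarrow> complex ^ 'n \<Rightarrow> complex"
  where "herm x y = (\<Sum>i\<in>UNIV. cnj (x $ i) * y $ i)"

definition orthonormal :: "(complex ^ 'n) list \<Rightarrow> bool"
  where "orthonormal vs \<longleftrightarrow>
    (\<forall>i<length vs. \<forall>j<length vs. herm (vs ! i) (vs ! j) = (if i = j then 1 else 0))"

definition orthonormal_basis :: "(complex ^ 'n) list \<Rightarrow> bool"
  where "orthonormal_basis vs \<longleftrightarrow> orthonormal vs \<and> vec.span (set vs) = UNIV"

definition is_state :: "complex ^ 'n \<Rightarrow> bool"
  where "is_state \<psi> \<longleftrightarrow> norm \<psi> = 1"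

definition product_state :: "two_qubit \<Rightarrow> bool"
  where "product_state \<psi> \<longleftrightarrow> is_state \<psi> \<and> (\<exists>u v. \<psi> = u \<otimes>\<^sub>q v)"

definition entangled_state :: "two_qubit \<Rightarrow> bool"
  where "entangled_state \<psi> \<longleftrightarrow> is_state \<psi> \<and> \<not> product_state \<psi>"

definition diagonal_state :: "two_qubit \<Rightarrow> bool"
  where "diagonal_state \<psi> \<longleftrightarrow> is_state \<psi> \<and>
    cnj (\<psi> $ (0, 0)) * \<psi> $ (0, 1) + cnj (\<psi> $ (1, 0)) * \<psi> $ (1, 1) = 0"

(* The list holds the triples (lambda_j, u_j, v_j). *)
definition schmidt_decomposition :: "two_qubit \<Rightarrow> (real \<times> qubit \<times> qubit) list \<Rightarrow> bool"
  where "schmidt_decomposition \<psi> ds \<longleftrightarrow>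
    \<psi> = (\<Sum>(l, u, v)\<leftarrow>ds. l *\<^sub>R (u \<otimes>\<^sub>q v)) \<and>
    (\<forall>(l, u, v)\<in>set ds. 0 \<le> l) \<and>
    orthonormal (map (\<lambda>(l, u, v). u) ds) \<and>
    orthonormal (map (\<lambda>(l, u, v). v) ds)"

definition Mmee :: two_qubit
  where "Mmee = (1 / sqrt 2) *\<^sub>R (ket2 0 0 + ket2 1 1)"

definition mMee :: "real \<Rightarrow> real \<Rightarrow> two_qubit"
  where "mMee \<theta> \<theta>' = (1 / sqrt 2) *\<^sub>R (cis \<theta> *s ket2 0 1 + cis \<theta>' *s ket2 1 0)"

definition mmEe :: "real \<Rightarrow> real \<Rightarrow> complex \<Rightarrow> complex \<Rightarrow> two_qubit"
  where "mmEe \<theta> \<theta>' a b =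
    (1 / sqrt 2) *\<^sub>R ((sqrt 2 *\<^sub>R col a (- cis (\<theta>' - \<theta>) * b)) \<otimes>\<^sub>q ket 0) +
    (1 / sqrt 2) *\<^sub>R ((sqrt 2 *\<^sub>R col b (- a)) \<otimes>\<^sub>q ket 1)"

definition mmeE :: "real \<Rightarrow> real \<Rightarrow> complex \<Rightarrow> complex \<Rightarrow> two_qubit"
  where "mmeE \<theta> \<theta>' a b =
    (1 / sqrt 2) *\<^sub>R ((sqrt 2 *\<^sub>R col (cnj b) (cis (\<theta>' - \<theta>) * cnj a)) \<otimes>\<^sub>q ket 0) +
    (1 / sqrt 2) *\<^sub>R ((sqrt 2 *\<^sub>R col (- cnj a) (- cnj b)) \<otimes>\<^sub>q ket 1)"

definition admissible :: "real \<Rightarrow> real \<Rightarrow> complex \<Rightarrow> complex \<Rightarrow> bool"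
  where "admissible \<theta> \<theta>' a b \<longleftrightarrow>
    (cmod a)\<^sup>2 + (cmod b)\<^sup>2 = 1 / 2 \<and>
    cis (\<theta>' - \<theta>) * b\<^sup>2 \<noteq> a\<^sup>2 \<and>
    cis ((\<theta>' - \<theta>) / 2) * cnj a * b + cis (- ((\<theta>' - \<theta>) / 2)) * a * cnj b = 0"

end

theory Submission
  imports Defs
begin

text \<open>Orthogonality to the two given states forces the coefficient vector
  \<open>(a, b, - \<omega> b, - a)\<close> with \<open>\<omega> = cis (\<theta>' - \<theta>)\<close>; the orthogonal complement
  of such a vector inside this two-dimensional space is spanned by the vector for
  \<open>(cnj b, - cnj a)\<close>. Being a product state means that the determinant of the coefficient matrix
  vanishes, and for both completing states this determinant is \<open>\<omega> b\<^sup>2 - a\<^sup>2\<close> up to conjugation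
  and a unit factor. Likewise both diagonality conditions are, up to sign, the equation in
  \<open>admissible\<close> divided by \<open>cis ((\<theta>' - \<theta>) / 2)\<close>.\<close>

section \<open>Coordinates of one-qubit and two-qubit vectors\<close>

lemma UNIV_2_zero: "(UNIV :: 2 set) = {0, 1}"
  using UNIV_2 by auto

lemma zero_or_one_2: "(i :: 2) = 0 \<or> i = 1"
  using UNIV_2_zero by blast

lemma sum_2_zero: "(\<Sum>i\<in>UNIV. f (i :: 2)) = f 0 + f 1"
  unfolding UNIV_2_zero by simp

lemma sum_2_2: "(\<Sum>p\<in>UNIV. f (p :: 2 \<times> 2)) = f (0, 0) + f (0, 1) + f (1, 0) + f (1, 1)"
proof -
  have *: "(UNIV :: (2 \<times> 2) set) = {(0, 0), (0, 1), (1, 0), (1, 1)}"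
    using zero_or_one_2 by auto
  show ?thesis
    unfolding * by (simp add: add.assoc)
qed

lemma two_qubit_eq_iff:
  "\<psi> = \<phi> \<longleftrightarrow> \<psi> $ (0, 0) = \<phi> $ (0, 0) \<and> \<psi> $ (0, 1) = \<phi> $ (0, 1) \<and>
    \<psi> $ (1, 0) = \<phi> $ (1, 0) \<and> \<psi> $ (1, 1) = (\<phi> :: two_qubit) $ (1, 1)"
proof -
  have "(\<forall>i :: 2. P i) \<longleftrightarrow> P 0 \<and> P 1" for P
    using zero_or_one_2 by metis
  then show ?thesis
    by (simp add: vec_eq_iff)
qed

lemma ket_nth [simp]: "ket j $ i = (if i = j then 1 else 0)"
  by (simp add: ket_def axis_def)

lemma col_nth [simp]: "col x y $ 0 = x" "col x y $ 1 = y"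
  by (simp_all add: col_def)

lemma tensor_nth [simp]: "(u \<otimes>\<^sub>q v) $ (i, j) = u $ i * v $ j"
  by (simp add: tensor_def)

text \<open>Expresses real scaling as complex multiplication, so that ring simplification applies;
  \<open>vector_scaleR_component\<close> is deleted in later simp calls because it would yield a
  real scaling of the coordinate instead.\<close>

lemma scaleR_vec_nth: "(r *\<^sub>R (x :: complex ^ 'n)) $ i = of_real r * x $ i"
  unfolding vector_scaleR_component by (rule scaleR_conv_of_real)

section \<open>The Hermitian form and orthonormal bases\<close>

lemma herm_cnj: "cnj (herm x y) = herm y x"
  by (simp add: herm_def mult.commute)

lemma herm_sum_right: "herm x (\<Sum>i\<in>A. c i *s f i) = (\<Sum>i\<in>A. c i * herm x (f i))"
  unfolding herm_def sum_distrib_left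
  by (subst sum.swap) (simp add: sum_distrib_left mult.left_commute)

lemma herm_self: "herm x x = of_real ((norm x)\<^sup>2)"
proof -
  have "cnj z * z = of_real ((cmod z)\<^sup>2)" for z
    unfolding complex_norm_square by (rule mult.commute)
  then show ?thesis
    by (simp add: herm_def norm_vec_def L2_set_def sum_nonneg del: of_real_power)
qed

lemma is_state_iff_herm: "is_state \<psi> \<longleftrightarrow> herm \<psi> \<psi> = 1"
proof -
  have "herm \<psi> \<psi> = 1 \<longleftrightarrow> (norm \<psi>)\<^sup>2 = 1"
    unfolding herm_self by (metis of_real_eq_1_iff)
  then show ?thesis
    by (simp add: is_state_def abs_square_eq_1)
qed

lemma herm_two_qubit:
  "herm (\<psi> :: two_qubit) \<phi> = cnj (\<psi> $ (0, 0)) * \<phi> $ (0, 0) + cnj (\<psi> $ (0, 1)) * \<phi> $ (0, 1) +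
    cnj (\<psi> $ (1, 0)) * \<phi> $ (1, 0) + cnj (\<psi> $ (1, 1)) * \<phi> $ (1, 1)"
  by (simp add: herm_def sum_2_2)

text \<open>Pairing a vanishing combination with one member isolates its coefficient, so the members
  are independent; their number is the complex dimension, so they span.\<close>

lemma orthonormal_basisI:
  fixes vs :: "(complex ^ 'n) list"
  assumes on: "orthonormal vs" and len: "length vs = CARD('n)"
  shows "orthonormal_basis vs"
proof -
  have herm_ii: "herm (vs ! i) (vs ! j) = (if i = j then 1 else 0)"
    if "i < length vs" "j < length vs" for i j
    using on that by (simp add: orthonormal_def)
  \<comment> \<open>Equal entries at two positions would give one Hermitian product both values 0
    and 1. Distinctness is what later turns the list length into a cardinality.\<close>
  have "distinct vs"
    unfolding distinct_conv_nth by (metis herm_ii zero_neq_one)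
  have herm_set: "herm v w = (if v = w then 1 else 0)" if "v \<in> set vs" "w \<in> set vs" for v w
    using that herm_ii by (metis in_set_conv_nth)
  have "vec.independent (set vs)"
  proof (rule vec.independent_if_scalars_zero)
    fix f v assume sum0: "(\<Sum>x\<in>set vs. f x *s x) = 0" and v: "v \<in> set vs"
    have "0 = herm v (\<Sum>x\<in>set vs. f x *s x)"
      by (simp add: sum0 herm_def)
    also have "\<dots> = (\<Sum>x\<in>set vs. if v = x then f x else 0)"
      unfolding herm_sum_right by (rule sum.cong) (auto simp: herm_set v)
    also have "\<dots> = f v"
      using v by simp
    finally show "f v = 0" by simp
  qed simp
  moreover have "card (set vs) = vec.dim (UNIV :: (complex ^ 'n) set)"
    using \<open>distinct vs\<close> len unfolding vec_dim_card by (simp add: distinct_card)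
  ultimately have "UNIV \<subseteq> vec.span (set vs)"
    by (intro vec.card_ge_dim_independent) auto
  then show ?thesis
    using on by (auto simp: orthonormal_basis_def)
qed

text \<open>Conjugate symmetry \<open>herm_cnj\<close> leaves only one order of each pair to check,
  here and for four vectors.\<close>

lemma orthonormal_2:
  "orthonormal [x, y] \<longleftrightarrow> herm x x = 1 \<and> herm y y = 1 \<and> herm x y = 0"
  unfolding orthonormal_def
  by (auto simp: less_Suc_eq numeral_eq_Suc all_conj_distrib) (metis herm_cnj complex_cnj_zero)

lemma orthonormal_4:
  "orthonormal [w, x, y, z] \<longleftrightarrow>
    herm w w = 1 \<and> herm x x = 1 \<and> herm y y = 1 \<and> herm z z = 1 \<and>
    herm w x = 0 \<and> herm w y = 0 \<and> herm w z = 0 \<and> herm x y = 0 \<and> herm x z = 0 \<and> herm y z = 0"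
  unfolding orthonormal_def
  by (auto simp: less_Suc_eq numeral_eq_Suc all_conj_distrib) (metis herm_cnj complex_cnj_zero)+

section \<open>Product vectors and invariance under global phases\<close>

lemma is_tensor_iff:
  "(\<exists>u v. \<psi> = u \<otimes>\<^sub>q v) \<longleftrightarrow> \<psi> $ (0, 0) * \<psi> $ (1, 1) = \<psi> $ (0, 1) * \<psi> $ (1, 0)"
proof
  assume det: "\<psi> $ (0, 0) * \<psi> $ (1, 1) = \<psi> $ (0, 1) * \<psi> $ (1, 0)"
  \<comment> \<open>If the corner entry is 0, the vanishing determinant kills another entry next to
    it, so the first row or the first column of the coefficient matrix is zero.\<close>
  consider "\<psi> $ (0, 0) \<noteq> 0" | "\<psi> $ (0, 0) = 0" "\<psi> $ (0, 1) = 0" | "\<psi> $ (0, 0) = 0" "\<psi> $ (1, 0) = 0"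
    using det by force
  then show "\<exists>u v. \<psi> = u \<otimes>\<^sub>q v"
  proof cases
    case 1
    \<comment> \<open>The determinant equation makes the second column a multiple of the first, with
      ratio \<open>\<psi> $ (0, 1) / \<psi> $ (0, 0)\<close>.\<close>
    then have "\<psi> = col (\<psi> $ (0, 0)) (\<psi> $ (1, 0)) \<otimes>\<^sub>q col 1 (\<psi> $ (0, 1) / \<psi> $ (0, 0))"
      using det by (simp add: two_qubit_eq_iff field_simps)
    then show ?thesis by blast
  next
    case 2
    then have "\<psi> = col 0 1 \<otimes>\<^sub>q col (\<psi> $ (1, 0)) (\<psi> $ (1, 1))"
      by (simp add: two_qubit_eq_iff)
    then show ?thesis by blast
  next
    case 3
    then have "\<psi> = col (\<psi> $ (0, 1)) (\<psi> $ (1, 1)) \<otimes>\<^sub>q col 0 1"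
      by (simp add: two_qubit_eq_iff)
    then show ?thesis by blast
  qed
qed auto

lemma entangled_state_iff:
  "entangled_state \<psi> \<longleftrightarrow>
    is_state \<psi> \<and> \<psi> $ (0, 0) * \<psi> $ (1, 1) \<noteq> \<psi> $ (0, 1) * \<psi> $ (1, 0)"
  by (auto simp: entangled_state_def product_state_def is_tensor_iff)

lemma cnj_mult_unit:
  assumes "cmod \<alpha> = 1"
  shows "cnj \<alpha> * \<alpha> = 1"
  using assms complex_norm_square[of \<alpha>] by (simp add: mult.commute)

lemma herm_scale_right: "herm x (c *s y) = c * herm x y"
  by (simp add: herm_def sum_distrib_left mult.left_commute)

lemma herm_phase: "herm (\<alpha> *s x) (\<beta> *s y) = cnj \<alpha> * \<beta> * herm x y"
  by (simp add: herm_def sum_distrib_left mult_ac)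

lemma is_state_phase:
  assumes "cmod \<alpha> = 1"
  shows "is_state (\<alpha> *s \<psi>) \<longleftrightarrow> is_state \<psi>"
  by (simp add: is_state_iff_herm herm_phase cnj_mult_unit[OF assms])

text \<open>The determinant is only multiplied by \<open>\<alpha>\<^sup>2\<close>, which is
  nonzero.\<close>

lemma entangled_state_phase:
  assumes "cmod \<alpha> = 1"
  shows "entangled_state (\<alpha> *s \<psi>) \<longleftrightarrow> entangled_state \<psi>"
  using assms by (auto simp: entangled_state_iff is_state_phase)

text \<open>Each summand is conjugate-linear in one entry and linear in the other, so the phase
  enters as \<open>cnj \<alpha> * \<alpha> = 1\<close>.\<close>

lemma diagonal_state_phase:
  assumes "cmod \<alpha> = 1"
  shows "diagonal_state (\<alpha> *s \<psi>) \<longleftrightarrow> diagonal_state \<psi>"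
proof -
  have "cnj (\<alpha> * x) * (\<alpha> * y) + cnj (\<alpha> * z) * (\<alpha> * t) = cnj x * y + cnj z * t" for x y z t
  proof -
    have "cnj (\<alpha> * x) * (\<alpha> * y) + cnj (\<alpha> * z) * (\<alpha> * t) = (cnj \<alpha> * \<alpha>) * (cnj x * y + cnj z * t)"
      by (simp add: algebra_simps)
    then show ?thesis
      by (simp add: cnj_mult_unit[OF assms])
  qed
  then show ?thesis
    by (simp add: diagonal_state_def is_state_phase[OF assms] del: complex_cnj_mult)
qed

section \<open>The orthogonal complement of the two given states\<close>

lemma mmEe_nth:
  "mmEe \<theta> \<theta>' a b $ (0, 0) = a" "mmEe \<theta> \<theta>' a b $ (0, 1) = b"
  "mmEe \<theta> \<theta>' a b $ (1, 0) = - cis (\<theta>' - \<theta>) * b" "mmEe \<theta> \<theta>' a b $ (1, 1) = - a"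
  by (simp_all add: mmEe_def scaleR_vec_nth del: vector_scaleR_component)

lemma mmeE_nth:
  "mmeE \<theta> \<theta>' a b $ (0, 0) = cnj b" "mmeE \<theta> \<theta>' a b $ (0, 1) = - cnj a"
  "mmeE \<theta> \<theta>' a b $ (1, 0) = cis (\<theta>' - \<theta>) * cnj a" "mmeE \<theta> \<theta>' a b $ (1, 1) = - cnj b"
  by (simp_all add: mmeE_def scaleR_vec_nth del: vector_scaleR_component)

text \<open>Both completing states belong to one family, so every fact about \<open>mmeE\<close>
  follows from one about \<open>mmEe\<close> at the parameters \<open>cnj b\<close> and
  \<open>- cnj a\<close>.\<close>

lemma mmeE_eq_mmEe: "mmeE \<theta> \<theta>' a b = mmEe \<theta> \<theta>' (cnj b) (- cnj a)"
  by (simp add: two_qubit_eq_iff mmEe_nth mmeE_nth)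

lemma herm_Mmee:
  "herm Mmee \<psi> = complex_of_real (1 / sqrt 2) * (\<psi> $ (0, 0) + \<psi> $ (1, 1))"
  by (simp add: herm_two_qubit Mmee_def ket2_def scaleR_vec_nth algebra_simps
      del: vector_scaleR_component)

lemma herm_mMee:
  "herm (mMee \<theta> \<theta>') \<psi> =
    complex_of_real (1 / sqrt 2) * (cis (- \<theta>) * \<psi> $ (0, 1) + cis (- \<theta>') * \<psi> $ (1, 0))"
  by (simp add: herm_two_qubit mMee_def ket2_def scaleR_vec_nth algebra_simps cis_cnj
      del: vector_scaleR_component)

lemma orthogonal_complement_iff:
  "herm Mmee \<psi> = 0 \<and> herm (mMee \<theta> \<theta>') \<psi> = 0 \<longleftrightarrow>
    \<psi> = mmEe \<theta> \<theta>' (\<psi> $ (0, 0)) (\<psi> $ (0, 1))"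
proof -
  \<comment> \<open>Pulling out the nonzero factor \<open>cis (- \<theta>')\<close> turns
    orthogonality to \<open>mMee\<close> into the formula for the entry at
    \<open>(1, 0)\<close>.\<close>
  have "cis (- \<theta>) * x + cis (- \<theta>') * y = cis (- \<theta>') * (cis (\<theta>' - \<theta>) * x + y)" for x y
    by (simp add: distrib_left mult.assoc[symmetric] cis_mult)
  then show ?thesis
    by (simp add: herm_Mmee herm_mMee two_qubit_eq_iff mmEe_nth add_eq_0_iff conj_commute)
qed

lemma given_states_orthonormal:
  "herm Mmee Mmee = 1" "herm (mMee \<theta> \<theta>') (mMee \<theta> \<theta>') = 1" "herm Mmee (mMee \<theta> \<theta>') = 0"
proof -
  have *: "complex_of_real (1 / sqrt 2) * complex_of_real (1 / sqrt 2) = 1 / 2"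
    by (simp flip: of_real_mult)
  have nth: "Mmee $ (0, 0) = complex_of_real (1 / sqrt 2)"
      "Mmee $ (1, 1) = complex_of_real (1 / sqrt 2)"
      "mMee \<theta> \<theta>' $ (0, 0) = 0" "mMee \<theta> \<theta>' $ (1, 1) = 0"
      "mMee \<theta> \<theta>' $ (0, 1) = complex_of_real (1 / sqrt 2) * cis \<theta>"
      "mMee \<theta> \<theta>' $ (1, 0) = complex_of_real (1 / sqrt 2) * cis \<theta>'"
    by (simp_all add: Mmee_def mMee_def ket2_def scaleR_vec_nth del: vector_scaleR_component)
  show "herm Mmee Mmee = 1" "herm Mmee (mMee \<theta> \<theta>') = 0"
    unfolding herm_Mmee nth distrib_left * by simp_all
  have "cis (- t) * (k * cis t) = k" for t k
    unfolding mult.left_commute[of "cis (- t)"] by (simp add: cis_mult)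
  then show "herm (mMee \<theta> \<theta>') (mMee \<theta> \<theta>') = 1"
    unfolding herm_mMee nth distrib_left by (simp only: *) simp
qed

text \<open>The phase cancels against its conjugate, so each parameter is counted twice. Up to this
  factor 2 the parametrization is an isometry, whence the normalization to
  \<open>1 / 2\<close>.\<close>

lemma herm_mmEe:
  "herm (mmEe \<theta> \<theta>' a b) (mmEe \<theta> \<theta>' c d) = 2 * (cnj a * c + cnj b * d)"
proof -
  have "cnj (cis t * b) * (cis t * d) = (cis (- t) * cis t) * (cnj b * d)" for t
    by (simp add: cis_cnj mult_ac)
  then have "cnj (cis t * b) * (cis t * d) = cnj b * d" for t
    by (simp add: cis_mult)
  then show ?thesis
    by (simp add: herm_two_qubit mmEe_nth del: complex_cnj_mult)
qed

section \<open>The conditions on the parameters\<close>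

lemma is_state_mmEe: "is_state (mmEe \<theta> \<theta>' a b) \<longleftrightarrow> (cmod a)\<^sup>2 + (cmod b)\<^sup>2 = 1 / 2"
proof -
  have "herm (mmEe \<theta> \<theta>' a b) (mmEe \<theta> \<theta>' a b) = of_real (2 * ((cmod a)\<^sup>2 + (cmod b)\<^sup>2))"
    unfolding herm_mmEe by (simp add: complex_norm_square mult.commute del: of_real_power)
  then have "is_state (mmEe \<theta> \<theta>' a b) \<longleftrightarrow> 2 * ((cmod a)\<^sup>2 + (cmod b)\<^sup>2) = 1"
    unfolding is_state_iff_herm by (metis of_real_eq_1_iff)
  then show ?thesis
    by auto
qed

text \<open>Divides by the unit \<open>cis (t / 2)\<close>: the symmetric half-angle form in
  \<open>admissible\<close> becomes the form with a single phase that direct computation of inner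
  products gives.\<close>

lemma half_phase_condition_iff:
  "cis (t / 2) * x + cis (- (t / 2)) * y = 0 \<longleftrightarrow> x + cis (- t) * y = 0"
proof -
  have "cis (t / 2) * x + cis (- (t / 2)) * y = cis (t / 2) * (x + cis (- t) * y)"
    by (simp add: distrib_left mult.assoc[symmetric] cis_mult)
  then show ?thesis by simp
qed

lemma diagonal_state_mmEe:
  "diagonal_state (mmEe \<theta> \<theta>' a b) \<longleftrightarrow> is_state (mmEe \<theta> \<theta>' a b) \<and>
    cis ((\<theta>' - \<theta>) / 2) * cnj a * b + cis (- ((\<theta>' - \<theta>) / 2)) * a * cnj b = 0"
proof -
  have "cnj (- cis t * b) * - a = cis (- t) * (a * cnj b)" for t
    by (simp add: cis_cnj)
  then show ?thesis
    unfolding diagonal_state_def mmEe_nth mult.assoc half_phase_condition_iff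
    by (simp only: minus_diff_eq)
qed

lemma entangled_state_mmEe:
  "entangled_state (mmEe \<theta> \<theta>' a b) \<longleftrightarrow> is_state (mmEe \<theta> \<theta>' a b) \<and>
    cis (\<theta>' - \<theta>) * b\<^sup>2 \<noteq> a\<^sup>2"
proof -
  \<comment> \<open>Both inequations say that \<open>w * b\<^sup>2 - a\<^sup>2\<close>, the
    determinant, is nonzero.\<close>
  have "a * - a \<noteq> b * (- w * b) \<longleftrightarrow> w * b\<^sup>2 \<noteq> a\<^sup>2" for w
    unfolding eq_iff_diff_eq_0[of "a * - a"] right_minus_eq[symmetric, of "w * b\<^sup>2"]
    by (simp add: power2_eq_square mult_ac)
  then show ?thesis
    unfolding entangled_state_iff mmEe_nth by simp
qed

lemma mmEe_entangled_diagonal_iff: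
  "entangled_state (mmEe \<theta> \<theta>' a b) \<and> diagonal_state (mmEe \<theta> \<theta>' a b) \<longleftrightarrow> admissible \<theta> \<theta>' a b"
  unfolding entangled_state_mmEe diagonal_state_mmEe admissible_def is_state_mmEe by blast

text \<open>Transfers the conditions to \<open>mmeE\<close>. An equality of the two squares,
  conjugated and multiplied by the phase, would be the one excluded for \<open>a\<close> and
  \<open>b\<close>; the last condition only changes sign.\<close>

lemma admissible_companion:
  assumes "admissible \<theta> \<theta>' a b"
  shows "admissible \<theta> \<theta>' (cnj b) (- cnj a)"
proof -
  have "cis (\<theta>' - \<theta>) * (cnj a)\<^sup>2 \<noteq> (cnj b)\<^sup>2"
  proof
    assume "cis (\<theta>' - \<theta>) * (cnj a)\<^sup>2 = (cnj b)\<^sup>2"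
    then have "cnj (cis (\<theta>' - \<theta>) * (cnj a)\<^sup>2) = cnj ((cnj b)\<^sup>2)"
      by (rule arg_cong)
    then have "cis (- (\<theta>' - \<theta>)) * a\<^sup>2 = b\<^sup>2"
      by (simp add: cis_cnj)
    then have "cis (\<theta>' - \<theta>) * b\<^sup>2 = (cis (\<theta>' - \<theta>) * cis (- (\<theta>' - \<theta>))) * a\<^sup>2"
      by (simp add: mult.assoc)
    then show False
      using assms by (simp add: cis_mult admissible_def)
  qed
  moreover have "cis ((\<theta>' - \<theta>) / 2) * cnj (cnj b) * (- cnj a) +
      cis (- ((\<theta>' - \<theta>) / 2)) * cnj b * cnj (- cnj a) =
      - (cis ((\<theta>' - \<theta>) / 2) * cnj a * b + cis (- ((\<theta>' - \<theta>) / 2)) * a * cnj b)"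
    by (simp add: mult_ac)
  ultimately show ?thesis
    using assms by (simp add: admissible_def add.commute del: minus_add_distrib)
qed

section \<open>Orthonormal completions and their uniqueness\<close>

lemma completion_orthonormal_basis:
  assumes "is_state (mmEe \<theta> \<theta>' a b)" "cmod \<alpha> = 1" "cmod \<beta> = 1"
  shows "orthonormal_basis [Mmee, mMee \<theta> \<theta>', \<alpha> *s mmEe \<theta> \<theta>' a b, \<beta> *s mmeE \<theta> \<theta>' a b]"
proof (rule orthonormal_basisI)
  \<comment> \<open>A member of the family is rebuilt from its own first-row entries, so it
    satisfies the right-hand side of \<open>orthogonal_complement_iff\<close>.\<close>
  have "herm Mmee (mmEe \<theta> \<theta>' c d) = 0" "herm (mMee \<theta> \<theta>') (mmEe \<theta> \<theta>' c d) = 0" for c d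
    using orthogonal_complement_iff[of "mmEe \<theta> \<theta>' c d" \<theta> \<theta>'] by (simp_all add: mmEe_nth)
  then have "herm Mmee (\<gamma> *s mmEe \<theta> \<theta>' c d) = 0"
      "herm (mMee \<theta> \<theta>') (\<gamma> *s mmEe \<theta> \<theta>' c d) = 0" for \<gamma> c d
    by (simp_all add: herm_scale_right)
  moreover have "is_state (mmEe \<theta> \<theta>' (cnj b) (- cnj a))"
    using assms(1) by (simp add: is_state_mmEe add.commute)
  \<comment> \<open>The sum is \<open>cnj a * cnj b - cnj b * cnj a\<close>.\<close>
  moreover have "herm (mmEe \<theta> \<theta>' a b) (mmEe \<theta> \<theta>' (cnj b) (- cnj a)) = 0"
    by (simp add: herm_mmEe mult.commute)
  ultimately show
    "orthonormal [Mmee, mMee \<theta> \<theta>', \<alpha> *s mmEe \<theta> \<theta>' a b, \<beta> *s mmeE \<theta> \<theta>' a b]"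
    using assms(1)
    by (simp add: orthonormal_4 given_states_orthonormal mmeE_eq_mmEe is_state_iff_herm
        herm_phase cnj_mult_unit[OF assms(2)] cnj_mult_unit[OF assms(3)])
qed simp

text \<open>In the plane the orthogonal complement of \<open>(a, b)\<close> is the line through
  \<open>(cnj b, - cnj a)\<close>, and equal lengths force the factor to be a phase. This fixes the
  second completing state once the first is given.\<close>

lemma orthogonal_unit_pair:
  fixes a b c d :: complex
  assumes ab: "(cmod a)\<^sup>2 + (cmod b)\<^sup>2 = 1 / 2" and cd: "(cmod c)\<^sup>2 + (cmod d)\<^sup>2 = 1 / 2"
    and orth: "cnj a * c + cnj b * d = 0"
  obtains \<beta> where "cmod \<beta> = 1" "c = \<beta> * cnj b" "d = - (\<beta> * cnj a)"
proof -
  \<comment> \<open>The projection coefficient: the Hermitian product of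
    \<open>(cnj b, - cnj a)\<close> with \<open>(c, d)\<close>, divided by the squared length
    \<open>1 / 2\<close>.\<close>
  define \<beta> where "\<beta> = 2 * (b * c - a * d)"
  have N: "a * cnj a + b * cnj b = 1 / 2"
    using arg_cong[OF ab, of complex_of_real] by (simp add: complex_norm_square del: of_real_power)
  have ac: "cnj a * c = - (cnj b * d)" and bd: "cnj b * d = - (cnj a * c)"
    using orth by (simp_all only: eq_neg_iff_add_eq_0 add.commute)
  have "\<beta> * cnj b = 2 * (b * cnj b * c - a * (cnj b * d))"
    by (simp add: \<beta>_def algebra_simps)
  also have "\<dots> = 2 * (a * cnj a + b * cnj b) * c"
    unfolding bd by (simp add: algebra_simps)
  finally have c: "c = \<beta> * cnj b"
    by (simp add: N)
  have "- (\<beta> * cnj a) = 2 * (a * cnj a * d - b * (cnj a * c))"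
    by (simp add: \<beta>_def algebra_simps)
  also have "\<dots> = 2 * (a * cnj a + b * cnj b) * d"
    unfolding ac by (simp add: algebra_simps)
  finally have d: "d = - (\<beta> * cnj a)"
    by (simp add: N)
  \<comment> \<open>The left side is the squared length of \<open>(c, d)\<close>.\<close>
  have "(cmod \<beta>)\<^sup>2 * ((cmod a)\<^sup>2 + (cmod b)\<^sup>2) = 1 / 2"
    using cd unfolding c d by (simp add: norm_mult power_mult_distrib algebra_simps)
  then have "cmod \<beta> = 1"
    unfolding ab by (simp add: abs_square_eq_1)
  with c d that show ?thesis by blast
qed

section \<open>Schmidt decompositions\<close>

lemma ket_orthonormal: "orthonormal [ket 0, ket 1]"
  by (simp add: orthonormal_2 herm_def sum_2_zero)

text \<open>The second factors are the standard basis and the weights are positive, so only the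
  columns of the coefficient matrix have to be orthonormal.\<close>

lemma coefficient_columns_schmidt:
  fixes u v :: qubit
  assumes "(1 / sqrt 2) *\<^sub>R (u \<otimes>\<^sub>q ket 0) + (1 / sqrt 2) *\<^sub>R (v \<otimes>\<^sub>q ket 1) = \<psi>"
    and "orthonormal [u, v]"
  shows "schmidt_decomposition \<psi> [(1 / sqrt 2, u, ket 0), (1 / sqrt 2, v, ket 1)]"
  using assms ket_orthonormal by (simp add: schmidt_decomposition_def)

text \<open>Normalization makes each rescaled column a unit vector, and the diagonality equation is
  the orthogonality of the two columns.\<close>

lemma mmEe_schmidt:
  assumes "admissible \<theta> \<theta>' a b"
  shows "schmidt_decomposition (mmEe \<theta> \<theta>' a b)
    [(1 / sqrt 2, sqrt 2 *\<^sub>R col a (- cis (\<theta>' - \<theta>) * b), ket 0),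
     (1 / sqrt 2, sqrt 2 *\<^sub>R col b (- a), ket 1)]"
proof (rule coefficient_columns_schmidt)
  have herm_col: "herm (sqrt 2 *\<^sub>R col x y) (sqrt 2 *\<^sub>R col z t) = 2 * (cnj x * z + cnj y * t)" for x y z t
  proof -
    have "complex_of_real (sqrt 2) * complex_of_real (sqrt 2) = 2"
      by (simp add: of_real_mult[symmetric] del: of_real_mult)
    then have "cnj (complex_of_real (sqrt 2) * p) * (complex_of_real (sqrt 2) * q) = 2 * (cnj p * q)"
      for p q
      by (metis complex_cnj_complex_of_real complex_cnj_mult mult.assoc mult.left_commute)
    then show ?thesis
      unfolding herm_def sum_2_zero scaleR_vec_nth by (simp only: col_nth distrib_left)
  qed
  have N: "a * cnj a + b * cnj b = 1 / 2"
    using assms arg_cong[of "(cmod a)\<^sup>2 + (cmod b)\<^sup>2" "1 / 2" complex_of_real]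
    by (simp add: complex_norm_square admissible_def del: of_real_power)
  have "cnj (cis t * b) * (cis t * b) = (cis (- t) * cis t) * (b * cnj b)" for t
    by (simp add: cis_cnj mult_ac)
  then have "cnj (cis t * b) * (cis t * b) = b * cnj b" for t
    by (simp add: cis_mult)
  moreover have "cnj a * b + cis (- (\<theta>' - \<theta>)) * (a * cnj b) = 0"
    using assms unfolding admissible_def mult.assoc half_phase_condition_iff by blast
  then have "cnj a * b + cnj (cis (\<theta>' - \<theta>) * b) * a = 0"
    by (simp add: cis_cnj mult_ac)
  ultimately show "orthonormal [sqrt 2 *\<^sub>R col a (- cis (\<theta>' - \<theta>) * b), sqrt 2 *\<^sub>R col b (- a)]"
    using N by (simp only: orthonormal_2 herm_col mult_minus_left mult_minus_right complex_cnj_minus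
        minus_minus mult.commute[of "cnj a"] mult.commute[of "cnj b"] add.commute) simp
qed (simp add: mmEe_def)

lemma mmeE_schmidt:
  assumes "admissible \<theta> \<theta>' a b"
  shows "schmidt_decomposition (mmeE \<theta> \<theta>' a b)
    [(1 / sqrt 2, sqrt 2 *\<^sub>R col (cnj b) (cis (\<theta>' - \<theta>) * cnj a), ket 0),
     (1 / sqrt 2, sqrt 2 *\<^sub>R col (- cnj a) (- cnj b), ket 1)]"
  using mmEe_schmidt[OF admissible_companion[OF assms]] by (simp add: mmeE_eq_mmEe)

section \<open>Characterization of the completing pairs\<close>

lemma completing_pair_iff:
  "entangled_state \<psi> \<and> diagonal_state \<psi> \<and> entangled_state \<phi> \<and> diagonal_state \<phi> \<and>
      orthonormal_basis [Mmee, mMee \<theta> \<theta>', \<psi>, \<phi>]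
    \<longleftrightarrow>
    (\<exists>a b. admissible \<theta> \<theta>' a b \<and>
      (\<exists>\<alpha> \<beta>. cmod \<alpha> = 1 \<and> cmod \<beta> = 1 \<and>
        \<psi> = \<alpha> *s mmEe \<theta> \<theta>' a b \<and> \<phi> = \<beta> *s mmeE \<theta> \<theta>' a b))"
proof
  assume *: "entangled_state \<psi> \<and> diagonal_state \<psi> \<and> entangled_state \<phi> \<and> diagonal_state \<phi> \<and>
      orthonormal_basis [Mmee, mMee \<theta> \<theta>', \<psi>, \<phi>]"
  \<comment> \<open>The entries of the first row are the parameters, since both vectors lie in the
    orthogonal complement of the given states.\<close>
  define a b c d where "a = \<psi> $ (0, 0)" "b = \<psi> $ (0, 1)" "c = \<phi> $ (0, 0)" "d = \<phi> $ (0, 1)"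
  have \<psi>: "\<psi> = mmEe \<theta> \<theta>' a b" and \<phi>: "\<phi> = mmEe \<theta> \<theta>' c d"
    using * orthogonal_complement_iff[of \<psi>] orthogonal_complement_iff[of \<phi>]
    by (auto simp: orthonormal_basis_def orthonormal_4 a_b_c_d_def)
  have ab: "admissible \<theta> \<theta>' a b" and cd: "admissible \<theta> \<theta>' c d"
    using * unfolding \<psi> \<phi> by (simp_all flip: mmEe_entangled_diagonal_iff)
  have "herm \<psi> \<phi> = 0"
    using * by (simp add: orthonormal_basis_def orthonormal_4)
  then have "cnj a * c + cnj b * d = 0"
    unfolding \<psi> \<phi> herm_mmEe by (simp del: distrib_left_numeral)
  then obtain \<beta> where \<beta>: "cmod \<beta> = 1" "c = \<beta> * cnj b" "d = - (\<beta> * cnj a)"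
    using ab cd orthogonal_unit_pair[of a b c d] unfolding admissible_def by blast
  then have "\<phi> = \<beta> *s mmeE \<theta> \<theta>' a b"
    by (simp add: \<phi> two_qubit_eq_iff mmEe_nth mmeE_nth mult_ac)
  \<comment> \<open>The parameters were read off from \<open>\<psi>\<close> itself, so its phase is
    already absorbed in them; only \<open>\<phi>\<close> carries a free one.\<close>
  moreover have "\<psi> = 1 *s mmEe \<theta> \<theta>' a b"
    by (simp add: \<psi>)
  ultimately show "\<exists>a b. admissible \<theta> \<theta>' a b \<and>
      (\<exists>\<alpha> \<beta>. cmod \<alpha> = 1 \<and> cmod \<beta> = 1 \<and>
        \<psi> = \<alpha> *s mmEe \<theta> \<theta>' a b \<and> \<phi> = \<beta> *s mmeE \<theta> \<theta>' a b)"
    using ab \<beta>(1) norm_one by blast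
next
  assume "\<exists>a b. admissible \<theta> \<theta>' a b \<and>
      (\<exists>\<alpha> \<beta>. cmod \<alpha> = 1 \<and> cmod \<beta> = 1 \<and>
        \<psi> = \<alpha> *s mmEe \<theta> \<theta>' a b \<and> \<phi> = \<beta> *s mmeE \<theta> \<theta>' a b)"
  then obtain a b \<alpha> \<beta> where ab: "admissible \<theta> \<theta>' a b" and unit: "cmod \<alpha> = 1" "cmod \<beta> = 1"
    and \<psi>: "\<psi> = \<alpha> *s mmEe \<theta> \<theta>' a b" and \<phi>: "\<phi> = \<beta> *s mmeE \<theta> \<theta>' a b"
    by blast
  have "is_state (mmEe \<theta> \<theta>' a b)"
    using ab by (simp add: is_state_mmEe admissible_def)
  then have "orthonormal_basis [Mmee, mMee \<theta> \<theta>', \<psi>, \<phi>]"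
    unfolding \<psi> \<phi> using unit by (rule completion_orthonormal_basis)
  moreover have "entangled_state \<psi> \<and> diagonal_state \<psi>"
    using ab unfolding \<psi> entangled_state_phase[OF unit(1)] diagonal_state_phase[OF unit(1)]
      mmEe_entangled_diagonal_iff .
  moreover have "entangled_state \<phi> \<and> diagonal_state \<phi>"
    using admissible_companion[OF ab]
    unfolding \<phi> entangled_state_phase[OF unit(2)] diagonal_state_phase[OF unit(2)] mmeE_eq_mmEe
      mmEe_entangled_diagonal_iff .
  ultimately show "entangled_state \<psi> \<and> diagonal_state \<psi> \<and> entangled_state \<phi> \<and>
      diagonal_state \<phi> \<and> orthonormal_basis [Mmee, mMee \<theta> \<theta>', \<psi>, \<phi>]"
    by blast
qed

theorem theorem20:
  fixes \<theta> \<theta>' :: real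
  shows "(\<forall>\<psi> \<phi>.
      entangled_state \<psi> \<and> diagonal_state \<psi> \<and> entangled_state \<phi> \<and> diagonal_state \<phi> \<and>
      orthonormal_basis [Mmee, mMee \<theta> \<theta>', \<psi>, \<phi>]
      \<longleftrightarrow>
      (\<exists>a b. admissible \<theta> \<theta>' a b \<and>
        (\<exists>\<alpha> \<beta>. cmod \<alpha> = 1 \<and> cmod \<beta> = 1 \<and>
          \<psi> = \<alpha> *s mmEe \<theta> \<theta>' a b \<and> \<phi> = \<beta> *s mmeE \<theta> \<theta>' a b)))
    \<and> (\<forall>a b. admissible \<theta> \<theta>' a b \<longrightarrow>
      schmidt_decomposition (mmEe \<theta> \<theta>' a b)
        [(1 / sqrt 2, sqrt 2 *\<^sub>R col a (- cis (\<theta>' - \<theta>) * b), ket 0),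
         (1 / sqrt 2, sqrt 2 *\<^sub>R col b (- a), ket 1)] \<and>
      schmidt_decomposition (mmeE \<theta> \<theta>' a b)
        [(1 / sqrt 2, sqrt 2 *\<^sub>R col (cnj b) (cis (\<theta>' - \<theta>) * cnj a), ket 0),
         (1 / sqrt 2, sqrt 2 *\<^sub>R col (- cnj a) (- cnj b), ket 1)])"
  by (intro conjI allI impI completing_pair_iff mmEe_schmidt mmeE_schmidt)

end
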